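(* The set $\mathcal{L}(3)$ contains infinitely many (pairwise non-isomorphic) irreducible critically $3$-frustrated signed graphs; i.e. $\mathcal{L}(3)$ is infinite.
   Context: A signed graph $(G,\sigma)$ is a finite graph $G$ (loops and multiple edges allowed) with $\sigma:E(G)\to\{+,-\}$. Switching at a vertex $v$ multiplies the signs of all edges at $v$ by $-$. The frustration index $\ell(G,\sigma)$ is the minimum number of negative edges over all signatures obtained from $\sigma$ by switchings. $(G,\sigma)$ is critically $k$-frustrated if $\ell(G,\sigma)=k$ and $\ell(G-e,\sigma)=k-1$ for every edge $e$. A $t$-multiedge $E_{xy}$ is a set of $t$ parallel edges joining distinct vertices $x,y$, all of the same sign. Subdividing at $E_{xy}$: delete $E_{xy}$, add a new vertex $w$, a $t$-multiedge $E_{xw}$ with the sign of $E_{xy}$ and an all-positive $t$-multiedge $E_{wy}$. A subdivision is obtained by a sequence of such operations; a signed graph is irreducible if it is not a proper subdivision of any signed graph. $\mathcal{L}(k)$ is the family of irreducible critically $k$-frustrated signed graphs. *)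

theory Defs
  imports Main
begin

datatype edge_sign = Positive | Negative

fun flip_sign :: "edge_sign \<Rightarrow> edge_sign" where
  "flip_sign Positive = Negative"
| "flip_sign Negative = Positive"

text \<open>Edges are abstract names, so parallel edges are possible; \<open>ends G e\<close> is the set of end vertices
  of \<open>e\<close>, a singleton when \<open>e\<close> is a loop. The values of \<open>ends\<close> and \<open>signature\<close> outside of \<open>edges G\<close>
  carry no meaning.\<close>

record ('v, 'e) sgraph =
  verts :: "'v set"
  edges :: "'e set"
  ends :: "'e \<Rightarrow> 'v set"
  signature :: "'e \<Rightarrow> edge_sign"

definition signed_graph :: "('v, 'e) sgraph \<Rightarrow> bool" where
  "signed_graph G \<longleftrightarrow> finite (verts G) \<and> finite (edges G) \<and>
     (\<forall>e\<in>edges G. ends G e \<subseteq> verts G \<and> (card (ends G e) = 1 \<or> card (ends G e) = 2))"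

definition no_isolated_vertex :: "('v, 'e) sgraph \<Rightarrow> bool" where
  "no_isolated_vertex G \<longleftrightarrow> (\<forall>v\<in>verts G. \<exists>e\<in>edges G. v \<in> ends G e)"

text \<open>A loop meets its vertex twice, so its sign is multiplied twice by \<open>-\<close> and stays the same.\<close>

definition switch :: "'v \<Rightarrow> ('v, 'e) sgraph \<Rightarrow> ('v, 'e) sgraph" where
  "switch v G = G\<lparr>signature := (\<lambda>e. if v \<in> ends G e \<and> ends G e \<noteq> {v}
                                  then flip_sign (signature G e) else signature G e)\<rparr>"

definition switching_equivalent :: "('v, 'e) sgraph \<Rightarrow> ('v, 'e) sgraph \<Rightarrow> bool" where
  "switching_equivalent = (\<lambda>G H. \<exists>v\<in>verts G. H = switch v G)\<^sup>*\<^sup>*"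

definition negative_edges :: "('v, 'e) sgraph \<Rightarrow> 'e set" where
  "negative_edges G = {e \<in> edges G. signature G e = Negative}"

definition frustration_index :: "('v, 'e) sgraph \<Rightarrow> nat" where
  "frustration_index G = (LEAST n. \<exists>H. switching_equivalent G H \<and> card (negative_edges H) = n)"

definition delete_edge :: "('v, 'e) sgraph \<Rightarrow> 'e \<Rightarrow> ('v, 'e) sgraph" where
  "delete_edge G e = G\<lparr>edges := edges G - {e}\<rparr>"

definition critically_frustrated :: "nat \<Rightarrow> ('v, 'e) sgraph \<Rightarrow> bool" where
  "critically_frustrated k G \<longleftrightarrow> frustration_index G = k \<and>
     (\<forall>e\<in>edges G. frustration_index (delete_edge G e) + 1 = k)"

text \<open>\<open>S\<close> need not contain all the edges of sign \<open>s\<close> between \<open>x\<close> and \<open>y\<close>.\<close>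

definition multiedge :: "('v, 'e) sgraph \<Rightarrow> edge_sign \<Rightarrow> 'v \<Rightarrow> 'v \<Rightarrow> 'e set \<Rightarrow> bool" where
  "multiedge G s x y S \<longleftrightarrow> S \<noteq> {} \<and> S \<subseteq> edges G \<and> x \<noteq> y \<and>
     (\<forall>e\<in>S. ends G e = {x, y} \<and> signature G e = s)"

text \<open>\<open>G\<close> arises from \<open>H\<close> by subdividing at the multiedge \<open>S\<close>, with an arbitrary choice of names for
  the new vertex \<open>w\<close> and for the new edges \<open>A\<close> and \<open>B\<close> (names of deleted edges may be reused).\<close>

definition subdivision_step :: "('v, 'e) sgraph \<Rightarrow> ('v, 'e) sgraph \<Rightarrow> bool" where
  "subdivision_step H G \<longleftrightarrow> (\<exists>s x y S w A B.
     multiedge H s x y S \<and> w \<notin> verts H \<and>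
     verts G = insert w (verts H) \<and>
     edges G = (edges H - S) \<union> A \<union> B \<and>
     A \<inter> B = {} \<and> (A \<union> B) \<inter> (edges H - S) = {} \<and>
     card A = card S \<and> card B = card S \<and>
     multiedge G s x w A \<and> multiedge G Positive w y B \<and>
     (\<forall>e\<in>edges H - S. ends G e = ends H e \<and> signature G e = signature H e))"

definition proper_subdivision :: "('v, 'e) sgraph \<Rightarrow> ('v, 'e) sgraph \<Rightarrow> bool" where
  "proper_subdivision = subdivision_step\<^sup>+\<^sup>+"

text \<open>As usual for signed graphs, switching-equivalent signatures are not distinguished: \<open>G\<close> also
  counts as reducible when only some switching of it is a proper subdivision. Otherwise the
  all-negative odd cycles, which are switching equivalent to subdivisions of shorter negative
  cycles, would be irreducible.\<close>

definition irreducible_sgraph :: "('v, 'e) sgraph \<Rightarrow> bool" where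
  "irreducible_sgraph G \<longleftrightarrow>
     \<not> (\<exists>G' H. switching_equivalent G G' \<and> signed_graph H \<and> proper_subdivision H G')"

text \<open>Isolated vertices do not affect frustration or criticality. They are excluded, since adding
  them to a single member would already make the family infinite.\<close>

definition \<L> :: "nat \<Rightarrow> ('v, 'e) sgraph set" where
  "\<L> k = {G. signed_graph G \<and> no_isolated_vertex G \<and>
            critically_frustrated k G \<and> irreducible_sgraph G}"

definition sign_isomorphic :: "('v, 'e) sgraph \<Rightarrow> ('v, 'e) sgraph \<Rightarrow> bool" where
  "sign_isomorphic G H \<longleftrightarrow> (\<exists>f g. bij_betw f (verts G) (verts H) \<and> bij_betw g (edges G) (edges H) \<and>
     (\<forall>e\<in>edges G. ends H (g e) = f ` ends G e \<and> signature H (g e) = signature G e))"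

text \<open>Isomorphism, likewise up to switching. This is coarser than \<^const>\<open>sign_isomorphic\<close>, so
  infinitely many classes here give infinitely many classes there.\<close>

definition sgraph_isomorphism :: "(('v, 'e) sgraph \<times> ('v, 'e) sgraph) set" where
  "sgraph_isomorphism = {(G, H). \<exists>G'. switching_equivalent G G' \<and> sign_isomorphic G' H}"

end

theory Submission
  imports Defs "HOL-Library.Disjoint_Sets" "HOL-Library.Nat_Bijection"
begin

text \<open>On the vertices \<open>0, \<dots>, n - 1\<close> of a circle take, for every step length \<open>s\<close> in a list \<open>ss\<close> of
  divisors of \<open>n\<close>, all edges from \<open>i\<close> to \<open>i + s\<close> modulo \<open>n\<close>, and let an edge be negative when it
  wraps around past \<open>0\<close>. The edges of one step length \<open>s\<close> form \<open>s\<close> cycles, each wrapping around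
  once, so there are \<open>sum_list ss\<close> edge-disjoint negative cycles and every switching leaves at
  least that many negative edges. Switching an initial segment of the vertices rotates the place
  where edges count as wrapping around, and exactly \<open>sum_list ss\<close> edges pass over any given place.
  Since every edge passes over some place, the graph is critical. A vertex created by a subdivision
  has at most two neighbours; with steps 1 and 2 every vertex has more. The steps
  \<open>2, 1, \<dots>, 1\<close> thus give a member of \<open>\<L> k\<close> for each \<open>k \<ge> 3\<close> and each even \<open>n \<ge> 4\<close>.\<close>

section \<open>Switching vertex sets\<close>

definition switched_negative_edges :: "('v, 'e) sgraph \<Rightarrow> 'v set \<Rightarrow> 'e set" where
  "switched_negative_edges G X =
     {e \<in> edges G. (signature G e = Negative) \<noteq> (ends G e \<inter> X \<noteq> {} \<and> \<not> ends G e \<subseteq> X)}"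

lemma signed_graph_endsE:
  assumes "signed_graph G" "e \<in> edges G"
  obtains u v where "ends G e = {u, v}" "u \<in> verts G" "v \<in> verts G"
proof -
  have "ends G e \<subseteq> verts G" "card (ends G e) = 1 \<or> card (ends G e) = 2"
    using assms by (auto simp: signed_graph_def)
  then show thesis
    using that by (fastforce simp: card_1_singleton_iff card_2_iff)
qed

lemma switch_simps [simp]:
  "verts (switch v G) = verts G" "edges (switch v G) = edges G" "ends (switch v G) = ends G"
  by (simp_all add: switch_def)

lemma signed_graph_switch: "signed_graph G \<Longrightarrow> signed_graph (switch v G)"
  by (simp add: signed_graph_def)

lemma signed_graph_delete_edge: "signed_graph G \<Longrightarrow> signed_graph (delete_edge G e)"
  by (simp add: signed_graph_def delete_edge_def)

lemma switching_equivalent_refl: "switching_equivalent G G"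
  by (simp add: switching_equivalent_def)

lemma switching_equivalent_same_ends:
  assumes "switching_equivalent G H"
  shows "verts H = verts G \<and> edges H = edges G \<and> ends H = ends G"
  using assms unfolding switching_equivalent_def
  by (induction rule: rtranclp_induct) auto

lemma switched_negative_edges_subset: "switched_negative_edges G X \<subseteq> edges G"
  by (auto simp: switched_negative_edges_def)

lemma finite_switched_negative_edges: "signed_graph G \<Longrightarrow> finite (switched_negative_edges G X)"
  by (rule finite_subset[OF switched_negative_edges_subset]) (simp add: signed_graph_def)

lemma switched_negative_edges_empty: "switched_negative_edges G {} = negative_edges G"
  by (simp add: switched_negative_edges_def negative_edges_def)

lemma mem_switched_negative_edges_iff:
  assumes "e \<in> edges G" "ends G e = {u, v}"
  shows "e \<in> switched_negative_edges G X \<longleftrightarrow>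
    (signature G e = Negative) \<noteq> ((u \<in> X) \<noteq> (v \<in> X))"
  using assms by (auto simp: switched_negative_edges_def)

lemma switched_negative_edges_delete_edge:
  "switched_negative_edges (delete_edge G e) X = switched_negative_edges G X - {e}"
  by (auto simp: switched_negative_edges_def delete_edge_def)

lemma flip_sign_eq_Negative_iff: "flip_sign s = Negative \<longleftrightarrow> s \<noteq> Negative"
  by (cases s) auto

lemma switched_negative_edges_switch:
  assumes "signed_graph G"
  shows "switched_negative_edges (switch v G) X = switched_negative_edges G (sym_diff X {v})"
proof -
  have "e \<in> switched_negative_edges (switch v G) X \<longleftrightarrow>
      e \<in> switched_negative_edges G (sym_diff X {v})" if e: "e \<in> edges G" for e
  proof -
    obtain a b where ab: "ends G e = {a, b}"
      using assms e by (rule signed_graph_endsE)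
    have "signature (switch v G) e = Negative \<longleftrightarrow>
        (signature G e = Negative) \<noteq> ((a = v) \<noteq> (b = v))"
      using ab by (auto simp: switch_def flip_sign_eq_Negative_iff)
    then show ?thesis
      using e ab by (auto simp: mem_switched_negative_edges_iff)
  qed
  then show ?thesis
    using switched_negative_edges_subset[of G "sym_diff X {v}"]
      switched_negative_edges_subset[of "switch v G" X]
    unfolding switch_simps by blast
qed

lemma negative_edges_switching_equivalent:
  assumes "signed_graph G" "switching_equivalent G H"
  shows "\<exists>X\<subseteq>verts G. negative_edges H = switched_negative_edges G X"
  using assms(2,1) unfolding switching_equivalent_def
proof (induction rule: converse_rtranclp_induct)
  case base
  show ?case
    by (rule exI[of _ "{}"]) (simp add: switched_negative_edges_empty)
next
  case (step G K)
  then obtain v where v: "v \<in> verts G" "K = switch v G" by blast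
  then obtain X where X: "X \<subseteq> verts G" "negative_edges H = switched_negative_edges K X"
    using step.IH signed_graph_switch[OF step.prems] by auto
  have "negative_edges H = switched_negative_edges G (sym_diff X {v})"
    using X(2) v(2) switched_negative_edges_switch[OF step.prems] by simp
  moreover have "sym_diff X {v} \<subseteq> verts G"
    using X(1) v(1) by blast
  ultimately show ?case by blast
qed

lemma switching_equivalent_realizes_set:
  assumes "signed_graph G" "X \<subseteq> verts G"
  shows "\<exists>H. switching_equivalent G H \<and> negative_edges H = switched_negative_edges G X"
proof -
  have "finite X"
    using assms by (auto simp: signed_graph_def intro: finite_subset)
  then show ?thesis
    using assms
  proof (induction X arbitrary: G)
    case empty
    show ?case
      by (rule exI[of _ G]) (simp add: switching_equivalent_refl switched_negative_edges_empty)
  next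
    case (insert v X)
    have "\<exists>H. switching_equivalent (switch v G) H \<and>
        negative_edges H = switched_negative_edges (switch v G) X"
      using insert.prems by (intro insert.IH signed_graph_switch) auto
    then obtain H where H: "switching_equivalent (switch v G) H"
      "negative_edges H = switched_negative_edges (switch v G) X" by blast
    have "sym_diff X {v} = insert v X"
      using insert.hyps by blast
    then have "negative_edges H = switched_negative_edges G (insert v X)"
      using H(2) switched_negative_edges_switch[OF insert.prems(1)] by simp
    moreover have "switching_equivalent G H"
      using H(1) insert.prems(2) unfolding switching_equivalent_def
      by (auto intro: converse_rtranclp_into_rtranclp)
    ultimately show ?case by blast
  qed
qed

section \<open>Frustration index and criticality\<close>

lemma frustration_index_le:
  assumes "signed_graph G" "X \<subseteq> verts G"
  shows "frustration_index G \<le> card (switched_negative_edges G X)"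
  unfolding frustration_index_def
  using switching_equivalent_realizes_set[OF assms] by (metis (mono_tags, lifting) Least_le)

lemma frustration_index_attained:
  assumes "signed_graph G"
  obtains X where "X \<subseteq> verts G" "frustration_index G = card (switched_negative_edges G X)"
proof -
  have "\<exists>H. switching_equivalent G H \<and> card (negative_edges H) = frustration_index G"
    unfolding frustration_index_def
    by (rule LeastI_ex) (use switching_equivalent_refl in blast)
  then show thesis
    using negative_edges_switching_equivalent[OF assms] that by metis
qed

lemma frustration_index_le_Suc_delete_edge:
  assumes "signed_graph G"
  shows "frustration_index G \<le> Suc (frustration_index (delete_edge G e))"
proof -
  obtain X where X: "X \<subseteq> verts (delete_edge G e)"
    "frustration_index (delete_edge G e) = card (switched_negative_edges (delete_edge G e) X)"
    using signed_graph_delete_edge[OF assms] by (rule frustration_index_attained)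
  have "X \<subseteq> verts G"
    using X(1) by (simp add: delete_edge_def)
  then have "frustration_index G \<le> card (switched_negative_edges G X)"
    by (rule frustration_index_le[OF assms])
  also have "\<dots> \<le> Suc (card (switched_negative_edges G X - {e}))"
    using diff_card_le_card_Diff[of "{e}" "switched_negative_edges G X"] by simp
  finally show ?thesis
    by (simp add: X(2) switched_negative_edges_delete_edge)
qed

lemma frustration_index_delete_edge_less:
  assumes "signed_graph G" "X \<subseteq> verts G" "e \<in> switched_negative_edges G X"
  shows "frustration_index (delete_edge G e) < card (switched_negative_edges G X)"
proof -
  have "frustration_index (delete_edge G e) \<le> card (switched_negative_edges (delete_edge G e) X)"
    using assms(1,2)
    by (intro frustration_index_le signed_graph_delete_edge) (simp_all add: delete_edge_def)
  also have "\<dots> < card (switched_negative_edges G X)"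
    unfolding switched_negative_edges_delete_edge
    using assms(1,3) by (intro card_Diff1_less finite_switched_negative_edges)
  finally show ?thesis .
qed

lemma critically_frustratedI:
  assumes "signed_graph G" "frustration_index G = k"
    and "\<And>e. e \<in> edges G \<Longrightarrow>
      \<exists>X\<subseteq>verts G. e \<in> switched_negative_edges G X \<and> card (switched_negative_edges G X) = k"
  shows "critically_frustrated k G"
  unfolding critically_frustrated_def
proof (intro conjI ballI)
  fix e assume "e \<in> edges G"
  then have "frustration_index (delete_edge G e) < k"
    using assms(3) frustration_index_delete_edge_less[OF assms(1)] by blast
  moreover have "k \<le> Suc (frustration_index (delete_edge G e))"
    using frustration_index_le_Suc_delete_edge[OF assms(1)] assms(2) by simp
  ultimately show "frustration_index (delete_edge G e) + 1 = k" by simp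
qed (fact assms(2))

section \<open>Negative closed walks\<close>

definition negative_closed_walk ::
    "('v, 'e) sgraph \<Rightarrow> nat \<Rightarrow> (nat \<Rightarrow> 'v) \<Rightarrow> (nat \<Rightarrow> 'e) \<Rightarrow> bool" where
  "negative_closed_walk G l c g \<longleftrightarrow>
     (\<forall>q<l. g q \<in> edges G \<and> ends G (g q) = {c q, c (Suc q)}) \<and> c l = c 0 \<and>
     odd (card {q. q < l \<and> signature G (g q) = Negative})"

lemma odd_card_changes_iff:
  fixes P :: "nat \<Rightarrow> bool"
  shows "odd (card {q. q < l \<and> P q \<noteq> P (Suc q)}) \<longleftrightarrow> P 0 \<noteq> P l"
proof (induction l)
  case (Suc l)
  let ?changes = "\<lambda>l. {q. q < l \<and> P q \<noteq> P (Suc q)}"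
  have "?changes (Suc l) = (if P l \<noteq> P (Suc l) then insert l (?changes l) else ?changes l)"
    by (auto simp: less_Suc_eq)
  then have "odd (card (?changes (Suc l))) \<longleftrightarrow> odd (card (?changes l)) \<noteq> (P l \<noteq> P (Suc l))"
    by simp
  then show ?case
    unfolding Suc.IH by blast
qed simp

lemma negative_closed_walk_meets_switched_negative_edges:
  assumes "negative_closed_walk G l c g"
  shows "\<exists>q<l. g q \<in> switched_negative_edges G X"
proof (rule ccontr)
  assume avoids: "\<not> (\<exists>q<l. g q \<in> switched_negative_edges G X)"
  have "signature G (g q) = Negative \<longleftrightarrow> (c q \<in> X) \<noteq> (c (Suc q) \<in> X)" if "q < l" for q
    using avoids that assms mem_switched_negative_edges_iff[of "g q" G "c q" "c (Suc q)" X]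
    by (auto simp: negative_closed_walk_def)
  then have "{q. q < l \<and> signature G (g q) = Negative} =
      {q. q < l \<and> (c q \<in> X) \<noteq> (c (Suc q) \<in> X)}" by blast
  then have "(c 0 \<in> X) \<noteq> (c l \<in> X)"
    using assms odd_card_changes_iff[of l "\<lambda>q. c q \<in> X"] by (simp add: negative_closed_walk_def)
  then show False
    using assms by (simp add: negative_closed_walk_def)
qed

lemma card_disjoint_negative_closed_walks_le_frustration_index:
  assumes "signed_graph G"
    and "\<And>i. i \<in> I \<Longrightarrow> negative_closed_walk G (l i) (c i) (g i)"
    and "disjoint_family_on (\<lambda>i. g i ` {..<l i}) I"
  shows "card I \<le> frustration_index G"
proof -
  obtain X where X: "frustration_index G = card (switched_negative_edges G X)"
    using assms(1) by (rule frustration_index_attained)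
  have "\<forall>i\<in>I. \<exists>q<l i. g i q \<in> switched_negative_edges G X"
    using assms(2) negative_closed_walk_meets_switched_negative_edges by blast
  then obtain q where q: "\<forall>i\<in>I. q i < l i \<and> g i (q i) \<in> switched_negative_edges G X"
    by metis
  have "inj_on (\<lambda>i. g i (q i)) I"
  proof (rule inj_onI, rule ccontr)
    fix i j assume ij: "i \<in> I" "j \<in> I" "g i (q i) = g j (q j)" "i \<noteq> j"
    then have "g i (q i) \<in> g i ` {..<l i} \<inter> g j ` {..<l j}"
      using q by (metis IntI imageI lessThan_iff)
    then show False
      using disjoint_family_onD[OF assms(3) ij(1,2,4)] by simp
  qed
  then show ?thesis
    unfolding X using q finite_switched_negative_edges[OF assms(1)]
    by (intro card_inj_on_le) auto
qed

section \<open>Irreducibility\<close>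

definition neighbours :: "('v, 'e) sgraph \<Rightarrow> 'v \<Rightarrow> 'v set" where
  "neighbours G v = {u. \<exists>e\<in>edges G. ends G e = {v, u}}"

lemma finite_neighbours: "signed_graph G \<Longrightarrow> finite (neighbours G v)"
  unfolding signed_graph_def neighbours_def by (auto intro!: finite_subset[of _ "verts G"])

lemma signed_graph_subdivision_step:
  assumes "signed_graph H" "subdivision_step H G"
  shows "signed_graph G"
proof -
  obtain s x y S w A B where S: "multiedge H s x y S"
    and verts: "verts G = insert w (verts H)" and edges: "edges G = (edges H - S) \<union> A \<union> B"
    and card: "card A = card S" "card B = card S"
    and new: "multiedge G s x w A" "multiedge G Positive w y B"
    and old: "\<forall>e\<in>edges H - S. ends G e = ends H e"
    using assms(2) unfolding subdivision_step_def by blast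
  obtain f where f: "f \<in> S" "f \<in> edges H" "ends H f = {x, y}"
    using S by (auto simp: multiedge_def)
  have "finite S"
    using S assms(1) by (auto simp: multiedge_def signed_graph_def intro: finite_subset)
  then have "0 < card S"
    using f(1) by (auto simp: card_gt_0_iff)
  then have "finite A" "finite B"
    using card by (auto intro: card_ge_0_finite)
  moreover have "x \<in> verts G" "y \<in> verts G" "w \<in> verts G"
    using assms(1) f(2,3) verts by (auto simp: signed_graph_def)
  moreover have "ends G e \<subseteq> verts G \<and> (card (ends G e) = 1 \<or> card (ends G e) = 2)"
    if "e \<in> edges H - S" for e
    using assms(1) that verts old by (auto simp: signed_graph_def)
  ultimately show ?thesis
    using assms(1) verts edges new by (auto simp: signed_graph_def multiedge_def)
qed

lemma subdivision_step_neighbours: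
  assumes "signed_graph H" "subdivision_step H G"
  shows "\<exists>w\<in>verts G. card (neighbours G w) \<le> 2"
proof -
  obtain s x y S w A B where w: "w \<notin> verts H" "w \<in> verts G"
    and edges: "edges G = (edges H - S) \<union> A \<union> B"
    and new: "multiedge G s x w A" "multiedge G Positive w y B"
    and old: "\<forall>e\<in>edges H - S. ends G e = ends H e"
    using assms(2) unfolding subdivision_step_def by blast
  have "u \<in> {x, y}" if "e \<in> edges G" "ends G e = {w, u}" for e u
  proof -
    have "e \<notin> edges H - S"
    proof
      assume "e \<in> edges H - S"
      then have "e \<in> edges H" "w \<in> ends H e"
        using old that(2) by auto
      then show False
        using w(1) assms(1) by (auto simp: signed_graph_def)
    qed
    then show ?thesis
      using that edges new by (auto simp: multiedge_def doubleton_eq_iff)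
  qed
  then have "neighbours G w \<subseteq> {x, y}"
    by (auto simp: neighbours_def)
  then have "card (neighbours G w) \<le> card {x, y}"
    by (intro card_mono) auto
  also have "\<dots> \<le> 2"
    by (simp add: card_insert_if)
  finally show ?thesis
    using w(2) by blast
qed

lemma proper_subdivision_neighbours:
  assumes "signed_graph H" "proper_subdivision H G"
  shows "\<exists>w\<in>verts G. card (neighbours G w) \<le> 2"
proof -
  have "signed_graph G \<and> (\<exists>w\<in>verts G. card (neighbours G w) \<le> 2)"
    using assms(2,1) unfolding proper_subdivision_def
    by (induction rule: tranclp_induct)
      (use signed_graph_subdivision_step subdivision_step_neighbours in blast)+
  then show ?thesis by blast
qed

lemma irreducible_sgraphI:
  assumes "\<And>v. v \<in> verts G \<Longrightarrow> 2 < card (neighbours G v)"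
  shows "irreducible_sgraph G"
  unfolding irreducible_sgraph_def
proof
  assume "\<exists>G' H. switching_equivalent G G' \<and> signed_graph H \<and> proper_subdivision H G'"
  then obtain G' H where G': "switching_equivalent G G'"
    and H: "signed_graph H" "proper_subdivision H G'" by blast
  have "verts G' = verts G" "neighbours G' = neighbours G"
    using switching_equivalent_same_ends[OF G'] by (auto simp: neighbours_def)
  then show False
    using proper_subdivision_neighbours[OF H] assms by force
qed

section \<open>Circulant signed graphs\<close>

definition circulant :: "nat \<Rightarrow> nat list \<Rightarrow> (nat, nat) sgraph" where
  "circulant n ss = \<lparr>verts = {..<n}, edges = prod_encode ` ({..<length ss} \<times> {..<n}),
     ends = (\<lambda>e. case prod_decode e of (t, i) \<Rightarrow> {i, (i + ss ! t) mod n}),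
     signature = (\<lambda>e. case prod_decode e of (t, i) \<Rightarrow>
       if n \<le> i + ss ! t then Negative else Positive)\<rparr>"

lemma verts_circulant [simp]: "verts (circulant n ss) = {..<n}"
  by (simp add: circulant_def)

lemma edges_circulant: "edges (circulant n ss) = prod_encode ` ({..<length ss} \<times> {..<n})"
  by (simp add: circulant_def)

lemma ends_circulant [simp]: "ends (circulant n ss) (prod_encode (t, i)) = {i, (i + ss ! t) mod n}"
  by (simp add: circulant_def)

lemma signature_circulant_eq_Negative_iff [simp]:
  "signature (circulant n ss) (prod_encode (t, i)) = Negative \<longleftrightarrow> n \<le> i + ss ! t"
  by (simp add: circulant_def)

lemma signed_graph_circulant: "signed_graph (circulant n ss)"
  by (auto simp: signed_graph_def edges_circulant card_insert_if)

lemma no_isolated_vertex_circulant: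
  assumes "ss \<noteq> []"
  shows "no_isolated_vertex (circulant n ss)"
  unfolding no_isolated_vertex_def
proof
  fix v assume "v \<in> verts (circulant n ss)"
  then have "prod_encode (0, v) \<in> edges (circulant n ss)"
    using assms by (auto simp: edges_circulant)
  then show "\<exists>e\<in>edges (circulant n ss). v \<in> ends (circulant n ss) e"
    by (rule bexI[rotated]) simp
qed

lemma neighbours_circulant:
  assumes "s \<in> set ss" "i < n"
  shows "(i + s) mod n \<in> neighbours (circulant n ss) i"
    and "i \<in> neighbours (circulant n ss) ((i + s) mod n)"
proof -
  obtain t where "t < length ss" "ss ! t = s"
    using assms(1) by (auto simp: in_set_conv_nth)
  then have "\<exists>e\<in>edges (circulant n ss). ends (circulant n ss) e = {i, (i + s) mod n}"
    using assms(2) by (auto simp: edges_circulant intro!: bexI[of _ "(t, i)"])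
  then show "(i + s) mod n \<in> neighbours (circulant n ss) i"
    and "i \<in> neighbours (circulant n ss) ((i + s) mod n)"
    by (auto simp: neighbours_def insert_commute)
qed

lemma inj_on_add_mod: "inj_on (\<lambda>a. (w + a) mod n) {..<n}" for w n :: nat
proof (rule linorder_inj_onI')
  fix a b assume "a \<in> {..<n}" "b \<in> {..<n}" "a < b"
  then have "\<not> n dvd (w + b) - (w + a)"
    by (simp add: nat_dvd_not_less)
  then show "(w + a) mod n \<noteq> (w + b) mod n"
    using mod_eq_dvd_iff_nat[of "w + a" "w + b" n] \<open>a < b\<close> by simp
qed

lemma irreducible_circulant:
  assumes "1 \<in> set ss" "2 \<in> set ss" "4 \<le> n"
  shows "irreducible_sgraph (circulant n ss)"
proof (rule irreducible_sgraphI)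
  fix w assume "w \<in> verts (circulant n ss)"
  then have w: "w < n" by simp
  let ?N = "neighbours (circulant n ss) w"
  define p where "p = (w + (n - 1)) mod n"
  have "p < n" "(p + 1) mod n = w"
    using w assms(3) by (simp_all add: p_def mod_simps)
  then have "p \<in> ?N"
    using neighbours_circulant(2)[OF assms(1), of p n] by simp
  then have "(\<lambda>a. (w + a) mod n) ` {1, 2, n - 1} \<subseteq> ?N"
    using neighbours_circulant(1)[OF assms(1) w] neighbours_circulant(1)[OF assms(2) w]
    by (simp add: p_def)
  moreover have "inj_on (\<lambda>a. (w + a) mod n) {1, 2, n - 1}"
    by (rule inj_on_subset[OF inj_on_add_mod]) (use assms(3) in auto)
  ultimately have "card {1, 2, n - 1} \<le> card ?N"
    using finite_neighbours[OF signed_graph_circulant] by (intro card_inj_on_le)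
  then show "2 < card ?N"
    using assms(3) by (simp add: card_insert_if split: if_splits)
qed

context
  fixes n :: nat and ss :: "nat list"
  assumes n_pos: "0 < n" and steps_dvd: "\<forall>s\<in>set ss. s dvd n"
begin

lemma step_bounds:
  assumes "t < length ss"
  shows "0 < ss ! t" "ss ! t \<le> n"
proof -
  have "ss ! t dvd n"
    using assms steps_dvd by simp
  then show "0 < ss ! t" "ss ! t \<le> n"
    using n_pos by (auto intro: dvd_pos_nat dvd_imp_le)
qed

lemma negative_closed_walk_circulant:
  assumes t: "t < length ss" and r: "r < ss ! t"
  shows "negative_closed_walk (circulant n ss) (n div ss ! t)
    (\<lambda>q. (r + q * ss ! t) mod n) (\<lambda>q. prod_encode (t, r + q * ss ! t))"
proof -
  let ?s = "ss ! t"
  define l where "l = n div ?s"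
  have n: "n = l * ?s"
    using steps_dvd nth_mem[OF t] by (simp add: l_def)
  have l: "0 < l"
    using n n_pos by (cases l) auto
  have start: "r + q * ?s < n" if "q < l" for q
  proof -
    have "r + q * ?s < Suc q * ?s" using r by simp
    also have "\<dots> \<le> n" unfolding n using that by (intro mult_le_mono1) simp
    finally show ?thesis .
  qed
  have wraps: "n \<le> r + q * ?s + ?s \<longleftrightarrow> q = l - 1" if "q < l" for q
  proof (cases "Suc q < l")
    case True
    then show ?thesis
      using start[of "Suc q"] by (simp add: ac_simps)
  next
    case False
    then have "l = Suc q" using that by simp
    then show ?thesis by (simp add: n)
  qed
  then have "{q. q < l \<and> n \<le> r + q * ?s + ?s} = {l - 1}"
    using l by auto
  then show ?thesis
    using start t unfolding negative_closed_walk_def l_def[symmetric]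
    by (auto simp: edges_circulant n[symmetric] ac_simps)
qed

lemma sum_list_le_frustration_index_circulant: "sum_list ss \<le> frustration_index (circulant n ss)"
proof -
  let ?I = "SIGMA t:{..<length ss}. {..<ss ! t}"
  let ?g = "\<lambda>i q. prod_encode (fst i, snd i + q * ss ! fst i)"
  have "card ?I \<le> frustration_index (circulant n ss)"
  proof (rule card_disjoint_negative_closed_walks_le_frustration_index[OF signed_graph_circulant])
    fix i assume "i \<in> ?I"
    then show "negative_closed_walk (circulant n ss) (n div ss ! fst i)
        (\<lambda>q. (snd i + q * ss ! fst i) mod n) (?g i)"
      by (auto intro: negative_closed_walk_circulant)
  next
    have "i = j" if "i \<in> ?I" "j \<in> ?I" "?g i q = ?g j q'" for i j q q'
    proof -
      have same_step: "fst i = fst j"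
        and same_start: "snd i + q * ss ! fst i = snd j + q' * ss ! fst i"
        using that(3) by auto
      have "snd i < ss ! fst i" "snd j < ss ! fst i"
        using that(1,2) same_step by auto
      then have "snd i = snd j"
        using same_start by (metis mod_less mod_mult_self1)
      with same_step show ?thesis
        by (rule prod_eqI)
    qed
    then show "disjoint_family_on (\<lambda>i. ?g i ` {..<n div ss ! fst i}) ?I"
      unfolding disjoint_family_on_def by blast
  qed
  then show ?thesis
    by (simp add: sum_list_sum_nth atLeast0LessThan)
qed

text \<open>The edge from \<open>i\<close> runs over the places \<open>i, \<dots>, i + ss ! t - 1\<close>; it is negative after the
  switching when one of these is \<open>v\<close> or \<open>v + n\<close>.\<close>

lemma mem_switched_negative_edges_circulant_iff:
  assumes "t < length ss" "i < n" "v < n"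
  shows "prod_encode (t, i) \<in> switched_negative_edges (circulant n ss) {..v} \<longleftrightarrow>
    i \<le> v \<and> v < i + ss ! t \<or> v + n < i + ss ! t"
proof -
  have "prod_encode (t, i) \<in> switched_negative_edges (circulant n ss) {..v} \<longleftrightarrow>
      (n \<le> i + ss ! t) \<noteq> ((i \<le> v) \<noteq> ((i + ss ! t) mod n \<le> v))"
    using assms(1,2) mem_switched_negative_edges_iff[of "prod_encode (t, i)" "circulant n ss"]
    by (simp add: edges_circulant)
  moreover have "(i + ss ! t) mod n = (if i + ss ! t < n then i + ss ! t else i + ss ! t - n)"
    using step_bounds(2)[OF assms(1)] assms(2) by (simp add: le_mod_geq)
  ultimately show ?thesis
    using step_bounds(2)[OF assms(1)] assms(2,3) by auto
qed

lemma card_switched_negative_edges_circulant_le: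
  assumes "v < n"
  shows "card (switched_negative_edges (circulant n ss) {..v}) \<le> sum_list ss"
proof -
  define starts where "starts t = {Suc v - ss ! t..<Suc v} \<union> {Suc v + n - ss ! t..<n}" for t
  have "switched_negative_edges (circulant n ss) {..v} \<subseteq>
      prod_encode ` (SIGMA t:{..<length ss}. starts t)"
  proof
    fix e assume e: "e \<in> switched_negative_edges (circulant n ss) {..v}"
    then obtain t i where "e = prod_encode (t, i)" "t < length ss" "i < n"
      by (auto simp: switched_negative_edges_def edges_circulant)
    then show "e \<in> prod_encode ` (SIGMA t:{..<length ss}. starts t)"
      using e mem_switched_negative_edges_circulant_iff[of t i v] assms
      by (auto simp: starts_def)
  qed
  then have "card (switched_negative_edges (circulant n ss) {..v}) \<le>
      card (SIGMA t:{..<length ss}. starts t)"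
    by (rule surj_card_le[rotated]) (simp add: starts_def)
  also have "\<dots> = (\<Sum>t<length ss. card (starts t))"
    by (rule card_SigmaI) (simp_all add: starts_def)
  also have "\<dots> \<le> (\<Sum>t<length ss. ss ! t)"
  proof (rule sum_mono)
    fix t assume "t \<in> {..<length ss}"
    then have "ss ! t \<le> n" by (simp add: step_bounds)
    have "card (starts t) \<le> (Suc v - (Suc v - ss ! t)) + (n - (Suc v + n - ss ! t))"
      unfolding starts_def by (rule order_trans[OF card_Un_le]) simp
    also have "\<dots> \<le> ss ! t"
      using \<open>ss ! t \<le> n\<close> by arith
    finally show "card (starts t) \<le> ss ! t" .
  qed
  also have "\<dots> = sum_list ss"
    by (simp add: sum_list_sum_nth atLeast0LessThan)
  finally show ?thesis .
qed

lemma critically_frustrated_circulant: "critically_frustrated (sum_list ss) (circulant n ss)"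
proof (rule critically_frustratedI[OF signed_graph_circulant])
  have index_eq: "frustration_index (circulant n ss) = sum_list ss"
    and card_eq: "card (switched_negative_edges (circulant n ss) {..v}) = sum_list ss"
    if "v < n" for v
  proof -
    have "frustration_index (circulant n ss) \<le> card (switched_negative_edges (circulant n ss) {..v})"
      using that by (intro frustration_index_le signed_graph_circulant) auto
    then show "frustration_index (circulant n ss) = sum_list ss"
      and "card (switched_negative_edges (circulant n ss) {..v}) = sum_list ss"
      using card_switched_negative_edges_circulant_le[OF that]
        sum_list_le_frustration_index_circulant by linarith+
  qed
  show "frustration_index (circulant n ss) = sum_list ss"
    using n_pos by (rule index_eq)
  fix e assume "e \<in> edges (circulant n ss)"
  then obtain t i where e: "e = prod_encode (t, i)" "t < length ss" "i < n"
    by (auto simp: edges_circulant)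
  then have "e \<in> switched_negative_edges (circulant n ss) {..i}"
    by (simp add: mem_switched_negative_edges_circulant_iff step_bounds)
  moreover have "card (switched_negative_edges (circulant n ss) {..i}) = sum_list ss"
    using e(3) by (rule card_eq)
  moreover have "{..i} \<subseteq> verts (circulant n ss)"
    using e(3) by auto
  ultimately show "\<exists>X\<subseteq>verts (circulant n ss). e \<in> switched_negative_edges (circulant n ss) X \<and>
      card (switched_negative_edges (circulant n ss) X) = sum_list ss" by blast
qed

lemma circulant_in_\<L>:
  assumes "1 \<in> set ss" "2 \<in> set ss" "4 \<le> n"
  shows "circulant n ss \<in> \<L> (sum_list ss)"
proof -
  have "ss \<noteq> []"
    using assms(1) by auto
  then show ?thesis
    using assms by (simp add: \<L>_def signed_graph_circulant no_isolated_vertex_circulant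
        critically_frustrated_circulant irreducible_circulant)
qed

end

section \<open>Isomorphism classes\<close>

lemma sgraph_isomorphism_refl: "(G, G) \<in> sgraph_isomorphism"
proof -
  have "sign_isomorphic G G"
    unfolding sign_isomorphic_def by (rule exI[of _ id], rule exI[of _ id]) simp
  then show ?thesis
    unfolding sgraph_isomorphism_def using switching_equivalent_refl by blast
qed

lemma sgraph_isomorphism_card_verts:
  assumes "(G, H) \<in> sgraph_isomorphism"
  shows "card (verts G) = card (verts H)"
proof -
  obtain G' where G': "switching_equivalent G G'" "sign_isomorphic G' H"
    using assms unfolding sgraph_isomorphism_def by blast
  have "card (verts G') = card (verts H)"
    using G'(2) unfolding sign_isomorphic_def by (blast dest: bij_betw_same_card)
  then show ?thesis
    using switching_equivalent_same_ends[OF G'(1)] by simp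
qed

lemma infinite_orders_imp_infinite_classes:
  assumes "infinite ((\<lambda>G. card (verts G)) ` \<G>)"
  shows "infinite (\<G> // sgraph_isomorphism)"
proof
  assume "finite (\<G> // sgraph_isomorphism)"
  define order_of_class where "order_of_class C = the_elem ((\<lambda>G. card (verts G)) ` C)"
    for C :: "('a, 'b) sgraph set"
  have "(\<lambda>H. card (verts H)) ` (sgraph_isomorphism `` {G}) = {card (verts G)}"
    for G :: "('a, 'b) sgraph"
    using sgraph_isomorphism_refl by (auto dest: sgraph_isomorphism_card_verts)
  then have "order_of_class (sgraph_isomorphism `` {G}) = card (verts G)" for G
    by (simp add: order_of_class_def)
  then have "(\<lambda>G. card (verts G)) ` \<G> \<subseteq> order_of_class ` (\<G> // sgraph_isomorphism)"
    by (metis image_subsetI imageI quotientI)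
  then show False
    using assms \<open>finite (\<G> // sgraph_isomorphism)\<close> finite_subset by blast
qed

theorem infinite_classes_\<L>:
  assumes "3 \<le> k"
  shows "infinite ((\<L> k :: (nat, nat) sgraph set) // sgraph_isomorphism)"
proof (rule infinite_orders_imp_infinite_classes)
  let ?ss = "2 # replicate (k - 2) (1 :: nat)"
  have "set ?ss = {1, 2}" "sum_list ?ss = k"
    using assms by (auto simp: sum_list_replicate)
  then have "circulant (2 * m) ?ss \<in> \<L> k" if "2 \<le> m" for m
    using circulant_in_\<L>[of "2 * m" ?ss] that by auto
  then have "(\<lambda>m. 2 * m) ` {2..} \<subseteq> (\<lambda>G. card (verts G)) ` (\<L> k :: (nat, nat) sgraph set)"
    by (force simp: image_iff)
  moreover have "infinite ((\<lambda>m :: nat. 2 * m) ` {2..})"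
    by (simp add: finite_image_iff inj_on_def infinite_Ici)
  ultimately show "infinite ((\<lambda>G. card (verts G)) ` (\<L> k :: (nat, nat) sgraph set))"
    by (rule infinite_super)
qed

theorem mainTheorem14:
  shows "infinite ((\<L> 3 :: (nat, nat) sgraph set) // sgraph_isomorphism)"
  by (rule infinite_classes_\<L>) simp

end
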